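(* Let $(\mu_k,L_k,T_k)_{0\le k<N+1}$ together with distinguished solutions $f_{k,h_k}$ satisfy the Standing Assumption described in the context. Suppose that there are constants $\alpha_j,\beta_j\in\mathbb{R}$, $1\le j<N+2$, such that $T_jf=\alpha_{j+1}f+\beta_{j+1}f'$ holds for all $0\le j<N+1$. Let $1\le m<N+1$, let $h\in C_b^m(\mathbb{R})$ with $\mu_0(h)=0$, and write $f:=f_{0,h}$. Suppose there exist constants $K_j$ and $D_j$, $0\le j<N+1$, such that $\|f_{j,h_j}\|\le K_j\|h_j\|$ and $\|f_{j,h_j}'\|\le D_j\|h_j\|$ for each $0\le j<N+1$ and each $h_j$ with $\mu_j(h_j)=0$. Put $a_j:=\big|\sum_{i=1}^j\alpha_i\big|$ and $b_j:=\big|\sum_{i=1}^j\beta_i\big|$. Then $$\|f^{(m+1)}\|\le\sum_{j=0}^{m-1}D_{m-j}\Big(\sum_{l\in I_j}A_{j,l}^{(m)}\Big)\|h^{(m-j)}\|+\Big(D_0\sum_{l\in I_m}A_{m,l}^{(m)}+a_1K_0D_1\sum_{l\in I_{m-1}}A_{m-1,l}^{(m)}\Big)\|h\|.$$ Here, for $j\in\{0,1,\dots\}$, $$I_j:=\Big\{j+1-\Big\lfloor\frac j2\Big\rfloor,\dots,j+1\Big\},$$ and, for $l\in I_j$, $$A_{j,l}^{(m)}:=\sum_{M\in\mathcal{S}_{j,l}^{(m)}}\ \prod_{i\in M\setminus\{m-j\}}\big(b_i1_{\{i-1\in M\}}+a_i1_{\{i-1\notin M\}}\big)D_i,$$ where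 $\mathcal{S}_{j,l}^{(m)}$ is the collection of those subsets $M$ of size $l$ of $\{m-j,m-j+1,\dots,m\}$ such that $\{m,m-j\}\subseteq M$ and $M\cap\{i,i+1\}\ne\emptyset$ for all $m-j\le i\le m-1$.
   Context: Notation. $\|\cdot\|$ is the supremum norm. $h\in C_b^m(\mathbb{R})$ means that $h^{(m-1)}$ exists and is absolutely continuous, with derivatives of $h$ up to order $m$ bounded; $h^{(0)}=h$. For a measure $\mu$, $\mu(h)=\int h\,d\mu$; $h$ is centred with respect to $\mu$ if $\mu(h)=0$. Empty products equal $1$. Standing Assumption. Fix $N\in\mathbb{N}\cup\{\infty\}$ and an order $p\in\mathbb{N}$. For $0\le k<N+1$ we are given a probability measure $\mu_k$ on $(\mathbb{R},\mathcal{B})$ and linear differential operators $$L_kf(x)=\sum_{j=0}^{p}a_{k,j}(x)f^{(j)}(x),\qquad T_kf(x)=\sum_{j=0}^{p}b_{k,j}(x)f^{(j)}(x),$$ where the leading coefficient $a_{k,p}$ does not depend on $k$ (the coefficient functions $a_{k,j}(x),b_{k,j}(x)$ are not to be confused with the constants $a_j,b_j$ of the claim). $L_k$ is characterizing for $\mu_k$: a random variable $X$ has law $\mu_k$ if and only if $\mathbb{E}[L_kf(X)]=0$ for all sufficiently smooth $f$. The operators are linked by $$\frac{d}{dx}L_kf(x)=L_{k+1}f'(x)-T_kf(x)\qquad\text{whenever } k+1<N+1.$$ For each $0\le k<N+1$ and each function $h_k$ with $\mu_k(h_k)=0$ there is a distinguished solution $f_{k,h_k}$ (a fixed, unambiguous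 choice of solution) of the Stein equation $L_kf=h_k$. Moreover, whenever $k+1<N+1$ (and $h_k$ is differentiable, so that the expression makes sense), the function $h_{k+1}:=h_k'+T_kf_{k,h_k}$ is integrable and centred with respect to $\mu_{k+1}$, and $f_{k,h_k}'$, which solves $L_{k+1}f=h_{k+1}$, is the distinguished solution of that equation: $f_{k,h_k}'=f_{k+1,h_{k+1}}$. *)

theory Defs
  imports "HOL-Probability.Probability"
begin

section \<open>Derivatives that need only exist almost everywhere\<close>

text \<open>The top derivative of a function in \<open>C\<^sub>b\<^sup>m\<close> exists only almost everywhere. Derivatives are made
  total by the value 0 where they do not exist; hence the supremum of \<open>\<bar>f'\<bar>\<close> over the real line is
  the supremum over the points where \<open>f\<close> is differentiable.\<close>

definition rderiv :: "(real \<Rightarrow> real) \<Rightarrow> real \<Rightarrow> real" where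
  "rderiv f x = (if f differentiable (at x) then deriv f x else 0)"

definition abs_cont_on :: "real set \<Rightarrow> (real \<Rightarrow> real) \<Rightarrow> bool" where
  "abs_cont_on I f \<longleftrightarrow> (\<forall>\<epsilon>>0. \<exists>\<delta>>0. \<forall>(n::nat) u v.
     (\<forall>i<n. u i \<le> v i \<and> {u i..v i} \<subseteq> I) \<and>
     (\<forall>i<n. \<forall>j<n. i \<noteq> j \<longrightarrow> {u i<..<v i} \<inter> {u j<..<v j} = {}) \<and>
     (\<Sum>i<n. v i - u i) < \<delta>
     \<longrightarrow> (\<Sum>i<n. \<bar>f (v i) - f (u i)\<bar>) < \<epsilon>)"

text \<open>Absolute continuity on the compact intervals contained in an open set \<open>S\<close>. The second conjunct
  follows from the first by Lebesgue's differentiation theorem, which is not in the library; it is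
  listed to make the almost everywhere existence of the derivative explicit. For a function with
  bounded derivative, absolute continuity on all compact intervals is the same as on the real line.\<close>

definition loc_abs_cont :: "real set \<Rightarrow> (real \<Rightarrow> real) \<Rightarrow> bool" where
  "loc_abs_cont S f \<longleftrightarrow> (\<forall>u v. {u..v} \<subseteq> S \<longrightarrow> abs_cont_on {u..v} f) \<and>
     (AE x in lborel. x \<in> S \<longrightarrow> f differentiable (at x))"

text \<open>\<open>f\<close> has an \<open>n\<close>-th derivative on \<open>S\<close> in the sense of the definition of \<open>C\<^sub>b\<^sup>n\<close>:
  \<open>f\<^sup>(\<^sup>n\<^sup>-\<^sup>1\<^sup>)\<close> exists and is (locally) absolutely continuous.\<close>

definition has_derivs_on :: "real set \<Rightarrow> nat \<Rightarrow> (real \<Rightarrow> real) \<Rightarrow> bool" where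
  "has_derivs_on S n f \<longleftrightarrow> (case n of 0 \<Rightarrow> True | Suc i \<Rightarrow>
     (\<forall>j<i. \<forall>x\<in>S. (rderiv ^^ j) f differentiable (at x)) \<and> loc_abs_cont S ((rderiv ^^ i) f))"

definition Cb :: "nat \<Rightarrow> (real \<Rightarrow> real) \<Rightarrow> bool" where
  "Cb m h \<longleftrightarrow> has_derivs_on UNIV m h \<and> (\<forall>j\<le>m. bounded (range ((rderiv ^^ j) h)))"

text \<open>\<open>deriv_norm n f\<close> is \<open>\<parallel>f\<^sup>(\<^sup>n\<^sup>)\<parallel>\<close>, infinite if \<open>f\<^sup>(\<^sup>n\<^sup>)\<close> is unbounded or does not exist. So a finite
  upper bound for it includes the existence of \<open>f\<^sup>(\<^sup>n\<^sup>)\<close>.\<close>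

definition deriv_norm :: "nat \<Rightarrow> (real \<Rightarrow> real) \<Rightarrow> ereal" where
  "deriv_norm n f =
     (if has_derivs_on UNIV n f then (SUP x. ereal \<bar>(rderiv ^^ n) f x\<bar>) else \<infinity>)"

definition Ck :: "nat \<Rightarrow> (real \<Rightarrow> real) \<Rightarrow> bool" where
  "Ck n f \<longleftrightarrow> (\<forall>j<n. \<forall>x. (rderiv ^^ j) f differentiable (at x)) \<and>
     continuous_on UNIV ((rderiv ^^ n) f)"


section \<open>Differential operators and Stein equations\<close>

definition diff_op :: "nat \<Rightarrow> (nat \<Rightarrow> real \<Rightarrow> real) \<Rightarrow> (real \<Rightarrow> real) \<Rightarrow> real \<Rightarrow> real" where
  "diff_op p c f x = (\<Sum>j\<le>p. c j x * (rderiv ^^ j) f x)"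

definition centred :: "real measure \<Rightarrow> (real \<Rightarrow> real) \<Rightarrow> bool" where
  "centred M h \<longleftrightarrow> integrable M h \<and> integral\<^sup>L M h = 0"

text \<open>Laws of real random variables are probability measures \<open>\<nu>\<close> on the Borel sets. Which functions
  are ``sufficiently smooth'' depends on the operator (growth or boundary conditions may enter), so
  any class \<open>F\<close> of functions of class \<open>C\<^sup>p\<close> is admitted.\<close>

definition characterizing :: "nat \<Rightarrow> (nat \<Rightarrow> real \<Rightarrow> real) \<Rightarrow> real measure \<Rightarrow> bool" where
  "characterizing p c M \<longleftrightarrow> (\<exists>F. (\<forall>f\<in>F. Ck p f) \<and>
     (\<forall>\<nu>. prob_space \<nu> \<and> sets \<nu> = sets borel \<longrightarrow>
       (\<nu> = M \<longleftrightarrow> (\<forall>f\<in>F. integrable \<nu> (diff_op p c f) \<and> integral\<^sup>L \<nu> (diff_op p c f) = 0))))"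

text \<open>For merely measurable \<open>h\<close> there is no classical solution. As usual for linear equations,
  \<open>f\<^sup>(\<^sup>p\<^sup>-\<^sup>1\<^sup>)\<close> is absolutely continuous away from the singular points (the zeros of the leading
  coefficient), and the equation holds almost everywhere.\<close>

definition solves :: "nat \<Rightarrow> (nat \<Rightarrow> real \<Rightarrow> real) \<Rightarrow> (real \<Rightarrow> real) \<Rightarrow> (real \<Rightarrow> real) \<Rightarrow> bool" where
  "solves p c h f \<longleftrightarrow> (\<forall>S. open S \<and> (\<forall>x\<in>S. c p x \<noteq> 0) \<longrightarrow> has_derivs_on S p f) \<and>
     (AE x in lborel. diff_op p c f x = h x)"

text \<open>The function \<open>h' + T f\<close>, set to 0 where \<open>h'\<close> does not exist.\<close>

definition next_rhs ::
    "nat \<Rightarrow> (nat \<Rightarrow> real \<Rightarrow> real) \<Rightarrow> (real \<Rightarrow> real) \<Rightarrow> (real \<Rightarrow> real) \<Rightarrow> real \<Rightarrow> real" where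
  "next_rhs p c h f x = (if h differentiable (at x) then deriv h x + diff_op p c f x else 0)"

text \<open>\<open>L\<^sub>k\<close> is \<open>diff_op p (a k)\<close>, \<open>T\<^sub>k\<close> is \<open>diff_op p (b k)\<close>, and \<open>sol k h\<close> is the distinguished
  solution of \<open>L\<^sub>k f = h\<close>. The recursion for distinguished solutions is required only for right-hand
  sides in \<open>C\<^sub>b\<^sup>1\<close>, since an unbounded \<open>h'\<close> need not be integrable.\<close>

locale stein_system =
  fixes N :: enat
    and p :: nat
    and \<mu> :: "nat \<Rightarrow> real measure"
    and a :: "nat \<Rightarrow> nat \<Rightarrow> real \<Rightarrow> real"
    and b :: "nat \<Rightarrow> nat \<Rightarrow> real \<Rightarrow> real"
    and sol :: "nat \<Rightarrow> (real \<Rightarrow> real) \<Rightarrow> real \<Rightarrow> real"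
  assumes prob: "\<And>k. enat k < N + 1 \<Longrightarrow> prob_space (\<mu> k) \<and> sets (\<mu> k) = sets borel"
    and leading: "\<And>k. enat k < N + 1 \<Longrightarrow> a k p = a 0 p"
    and characterizing: "\<And>k. enat k < N + 1 \<Longrightarrow> characterizing p (a k) (\<mu> k)"
    and link: "\<And>k f x. enat (k + 1) < N + 1 \<Longrightarrow> Ck (p + 1) f \<Longrightarrow>
      (diff_op p (a k) f has_real_derivative
        diff_op p (a (k + 1)) (rderiv f) x - diff_op p (b k) f x) (at x)"
    and solution: "\<And>k h. enat k < N + 1 \<Longrightarrow> centred (\<mu> k) h \<Longrightarrow> solves p (a k) h (sol k h)"
    and next_centred: "\<And>k h. enat (k + 1) < N + 1 \<Longrightarrow> centred (\<mu> k) h \<Longrightarrow> Cb 1 h \<Longrightarrow>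
      centred (\<mu> (k + 1)) (next_rhs p (b k) h (sol k h))"
    and next_solution: "\<And>k h x. enat (k + 1) < N + 1 \<Longrightarrow> centred (\<mu> k) h \<Longrightarrow> Cb 1 h \<Longrightarrow>
      (sol k h has_real_derivative sol (k + 1) (next_rhs p (b k) h (sol k h)) x) (at x)"


section \<open>The combinatorial coefficients\<close>

definition abs_psum :: "(nat \<Rightarrow> real) \<Rightarrow> nat \<Rightarrow> real" where
  "abs_psum \<gamma> j = \<bar>\<Sum>i=1..j. \<gamma> i\<bar>"

definition I_set :: "nat \<Rightarrow> nat set" where
  "I_set j = {j + 1 - j div 2..j + 1}"

definition S_set :: "nat \<Rightarrow> nat \<Rightarrow> nat \<Rightarrow> nat set set" where
  "S_set m j l = {M. M \<subseteq> {m - j..m} \<and> card M = l \<and> {m, m - j} \<subseteq> M \<and>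
     (\<forall>i. m - j \<le> i \<and> i + 1 \<le> m \<longrightarrow> M \<inter> {i, i + 1} \<noteq> {})}"

definition A_coeff ::
    "(nat \<Rightarrow> real) \<Rightarrow> (nat \<Rightarrow> real) \<Rightarrow> (nat \<Rightarrow> real) \<Rightarrow> nat \<Rightarrow> nat \<Rightarrow> nat \<Rightarrow> real" where
  "A_coeff \<alpha> \<beta> D m j l = (\<Sum>M\<in>S_set m j l. \<Prod>i\<in>M - {m - j}.
     (abs_psum \<beta> i * of_bool (i - 1 \<in> M) + abs_psum \<alpha> i * of_bool (i - 1 \<notin> M)) * D i)"

end

theory Submission
  imports Defs
begin

text \<open>Differentiating the Stein equation \<open>k\<close> times shows that \<open>f\<^sup>(\<^sup>k\<^sup>)\<close> is the distinguished solution at level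
  \<open>k\<close> for the right-hand side \<open>u\<^sub>k = h\<^sup>(\<^sup>k\<^sup>) + (\<alpha>\<^sub>1 + \<dots> + \<alpha>\<^sub>k) f\<^sup>(\<^sup>k\<^sup>-\<^sup>1\<^sup>) + (\<beta>\<^sub>1 + \<dots> + \<beta>\<^sub>k) f\<^sup>(\<^sup>k\<^sup>)\<close>, so the norms
  of the derivatives of \<open>f\<close> satisfy the second order recursion
  \<open>\<parallel>f\<^sup>(\<^sup>k\<^sup>+\<^sup>1\<^sup>)\<parallel> \<le> D\<^sub>k (\<parallel>h\<^sup>(\<^sup>k\<^sup>)\<parallel> + a\<^sub>k \<parallel>f\<^sup>(\<^sup>k\<^sup>-\<^sup>1\<^sup>)\<parallel> + b\<^sub>k \<parallel>f\<^sup>(\<^sup>k\<^sup>)\<parallel>)\<close>. Unrolled from \<open>m + 1\<close> downwards, it becomes a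
  sum over descending paths with steps 1 and 2; the set \<open>M\<close> in the claim is the set of nodes of such a
  path. The analytic difficulty is that \<open>u\<^sub>k\<close> must be shown to lie in \<open>C\<^sub>b\<^sup>1\<close> before its summands are
  known to be differentiable everywhere: an absolutely continuous function with bounded derivative is
  Lipschitz, and Lipschitz bounds survive sums while pointwise bounds for \<open>rderiv\<close> do not.\<close>

section \<open>Absolute continuity and Lipschitz continuity\<close>

lemma rderiv_eq: "(F has_real_derivative F') (at x) \<Longrightarrow> rderiv F x = F'"
  by (auto simp: rderiv_def real_differentiable_def DERIV_imp_deriv)

lemma real_differentiableI: "(F has_real_derivative F') (at x) \<Longrightarrow> F differentiable (at x)"
  by (auto simp: real_differentiable_def)

lemma has_rderiv: "F differentiable (at x) \<Longrightarrow> (F has_real_derivative rderiv F x) (at x)"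
  for F :: "real \<Rightarrow> real"
  by (simp add: rderiv_def DERIV_deriv_iff_real_differentiable)

text \<open>Splitting the increment at \<open>x\<close> costs nothing, because
  \<open>c \<le> x \<le> d\<close> gives
  \<open>\<bar>c - x\<bar> + \<bar>d - x\<bar> = d - c\<close>. Hence the bound holds wherever the
  tag \<open>x\<close> sits in the interval.\<close>

lemma derivative_straddle:
  fixes F :: "real \<Rightarrow> real"
  assumes "F differentiable (at x)" and "\<bar>rderiv F x\<bar> \<le> C" and "\<eta> > 0"
  shows "\<exists>r>0. \<forall>c d. c \<le> x \<longrightarrow> x \<le> d \<longrightarrow> {c..d} \<subseteq> ball x r \<longrightarrow> \<bar>F d - F c\<bar> \<le> (C + \<eta>) * (d - c)"
proof -
  have "(F has_derivative (*) (rderiv F x)) (at x)"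
    using has_rderiv[OF assms(1)] by (simp add: has_field_derivative_def)
  then obtain r where r: "r > 0"
    and *: "\<And>y. norm (y - x) < r \<Longrightarrow> norm (F y - F x - rderiv F x * (y - x)) \<le> \<eta> * norm (y - x)"
    using assms(3) unfolding has_derivative_at_alt by meson
  have **: "\<bar>F y - F x\<bar> \<le> (C + \<eta>) * \<bar>y - x\<bar>" if "\<bar>y - x\<bar> < r" for y
  proof -
    have "\<bar>F y - F x\<bar> \<le> \<bar>rderiv F x * (y - x)\<bar> + \<eta> * \<bar>y - x\<bar>"
      using *[of y] that by (simp add: abs_if split: if_splits)
    also have "\<bar>rderiv F x * (y - x)\<bar> \<le> C * \<bar>y - x\<bar>"
      unfolding abs_mult by (intro mult_right_mono assms) auto
    finally show ?thesis by (simp add: algebra_simps)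
  qed
  show ?thesis
  proof (intro exI[of _ r] conjI allI impI r)
    fix c d assume cd: "c \<le> x" "x \<le> d" "{c..d} \<subseteq> ball x r"
    then have "c \<in> ball x r" "d \<in> ball x r" by (meson atLeastAtMost_iff order_refl order_trans subsetD)+
    then have "\<bar>c - x\<bar> < r" "\<bar>d - x\<bar> < r" by (auto simp: dist_real_def)
    with ** have "\<bar>F c - F x\<bar> \<le> (C + \<eta>) * \<bar>c - x\<bar>" "\<bar>F d - F x\<bar> \<le> (C + \<eta>) * \<bar>d - x\<bar>" by auto
    with cd show "\<bar>F d - F c\<bar> \<le> (C + \<eta>) * (d - c)" by (simp add: algebra_simps)
  qed
qed

text \<open>The exceptional set need not be measurable, so it is first enclosed in a Borel null set,
  to which outer regularity applies.\<close>

lemma AE_open_cover_exceptions: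
  fixes \<delta> :: real
  assumes "AE x in lborel. P x" and "\<delta> > 0"
  obtains W :: "real set" where "open W" "{x. \<not> P x} \<subseteq> W" "emeasure lborel W < ennreal \<delta>"
proof -
  obtain Z where Z: "{x \<in> space lborel. \<not> P x} \<subseteq> Z" "emeasure lborel Z = 0" "Z \<in> sets lborel"
    by (rule AE_E[OF assms(1)])
  obtain W where W: "open W" "Z \<subseteq> W" "emeasure lborel (W - Z) < ennreal \<delta>"
    using outer_regular_lborel[of Z "\<delta>"] Z(3) assms(2) by auto
  have "emeasure lborel W = emeasure lborel (Z \<union> (W - Z))"
    using W by (intro arg_cong[where f = "emeasure lborel"]) auto
  also have "\<dots> \<le> emeasure lborel Z + emeasure lborel (W - Z)"
    using Z W by (intro emeasure_subadditive) auto
  also have "\<dots> < ennreal \<delta>" using Z W by simp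
  finally show ?thesis using W Z by (intro that[of W]) auto
qed

text \<open>Nonoverlapping intervals inside \<open>W\<close> have total length at most the measure
  of \<open>W\<close>. This puts absolute continuity into a form suited to gauge arguments.\<close>

lemma abs_cont_on_tagged_partial:
  assumes "abs_cont_on {u..v} F" and "e > 0"
  shows "\<exists>\<delta>>0. \<forall>q W. q tagged_partial_division_of {u..v} \<longrightarrow> open W \<longrightarrow> emeasure lborel W < ennreal \<delta> \<longrightarrow>
      (\<forall>(x, k)\<in>q. k \<subseteq> W) \<longrightarrow> (\<Sum>(x, k)\<in>q. \<bar>F (Sup k) - F (Inf k)\<bar>) < e"
proof -
  obtain \<delta> where \<delta>: "\<delta> > 0" and ac: "\<And>(n::nat) c d. (\<forall>i<n. c i \<le> d i \<and> {c i..d i} \<subseteq> {u..v}) \<Longrightarrow>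
     (\<forall>i<n. \<forall>j<n. i \<noteq> j \<longrightarrow> {c i<..<d i} \<inter> {c j<..<d j} = {}) \<Longrightarrow>
     (\<Sum>i<n. d i - c i) < \<delta> \<Longrightarrow> (\<Sum>i<n. \<bar>F (d i) - F (c i)\<bar>) < e"
    using assms unfolding abs_cont_on_def by meson
  show ?thesis
  proof (intro exI[of _ \<delta>] conjI allI impI \<delta>)
    fix q and W :: "real set"
    assume q: "q tagged_partial_division_of {u..v}" and W: "open W" "emeasure lborel W < ennreal \<delta>"
      and sub: "\<forall>(x, k)\<in>q. k \<subseteq> W"
    define n where "n = card q"
    obtain \<phi> where \<phi>: "bij_betw \<phi> {..<n} q"
      using ex_bij_betw_nat_finite[of q] tagged_partial_division_ofD(1)[OF q]
      by (auto simp: n_def atLeast0LessThan)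
    define c where "c i = Inf (snd (\<phi> i))" for i
    define d where "d i = Sup (snd (\<phi> i))" for i
    have in_q: "(fst (\<phi> i), snd (\<phi> i)) \<in> q" if "i < n" for i
      using \<phi> that by (auto simp: bij_betw_def)
    have int: "snd (\<phi> i) = {c i..d i} \<and> c i \<le> d i" if i: "i < n" for i
    proof -
      obtain s t where st: "snd (\<phi> i) = {s..t}"
        using tagged_partial_division_ofD(4)[OF q in_q[OF i]] by auto
      moreover have "fst (\<phi> i) \<in> snd (\<phi> i)"
        using tagged_partial_division_ofD(2)[OF q in_q[OF i]] .
      ultimately have "s \<le> t" by auto
      with st show ?thesis by (simp add: c_def d_def)
    qed
    have disj: "{c i<..<d i} \<inter> {c j<..<d j} = {}" if "i < n" "j < n" "i \<noteq> j" for i j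
    proof -
      have "\<phi> i \<noteq> \<phi> j" using \<phi> that by (auto simp: bij_betw_def inj_on_def)
      then have "interior (snd (\<phi> i)) \<inter> interior (snd (\<phi> j)) = {}"
        using tagged_partial_division_ofD(5)[OF q in_q[OF that(1)] in_q[OF that(2)]]
        by (simp add: prod_eq_iff)
      then show ?thesis using int that by simp
    qed
    have inW: "{c i..d i} \<subseteq> W" if "i < n" for i using sub in_q[OF that] int[OF that] by auto
    have "ennreal (\<Sum>i<n. d i - c i) = (\<Sum>i<n. emeasure lborel {c i<..<d i})"
      using int by (subst sum_ennreal[symmetric]) (auto intro!: sum.cong)
    also have "\<dots> = emeasure lborel (\<Union>i<n. {c i<..<d i})"
      using disj by (intro sum_emeasure) (auto simp: disjoint_family_on_def)
    also have "\<dots> \<le> emeasure lborel W"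
      using W(1) inW by (intro emeasure_mono) (fastforce+)
    also have "\<dots> < ennreal \<delta>" by fact
    finally have "(\<Sum>i<n. d i - c i) < \<delta>"
      by (meson ennreal_leI not_le)
    then have "(\<Sum>i<n. \<bar>F (d i) - F (c i)\<bar>) < e"
      using int disj tagged_partial_division_ofD(3)[OF q in_q] by (intro ac) auto
    moreover have "(\<Sum>(x, k)\<in>q. \<bar>F (Sup k) - F (Inf k)\<bar>) = (\<Sum>i<n. \<bar>F (d i) - F (c i)\<bar>)"
      by (subst sum.reindex_bij_betw[OF \<phi>, symmetric]) (simp add: c_def d_def case_prod_unfold)
    ultimately show "(\<Sum>(x, k)\<in>q. \<bar>F (Sup k) - F (Inf k)\<bar>) < e" by simp
  qed
qed

text \<open>Compare \<open>F\<close> with its derivative along a tagged division that is fine for a gauge which confines the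
  intervals tagged at points of non-differentiability to an open set of small measure, where absolute
  continuity controls the increments.\<close>

lemma loc_abs_cont_increment_le:
  assumes F: "loc_abs_cont UNIV F" and C: "\<And>x. \<bar>rderiv F x\<bar> \<le> C" and uv: "u \<le> v"
  shows "\<bar>F v - F u\<bar> \<le> C * (v - u)"
proof (rule field_le_epsilon)
  fix e :: real assume e: "e > 0"
  \<comment> \<open>The summand 1 in the denominator covers the case \<open>u = v\<close>.\<close>
  define \<eta> where "\<eta> = e / 2 / (v - u + 1)"
  have \<eta>: "\<eta> > 0" "\<eta> * (v - u) \<le> e / 2" using e uv by (auto simp: \<eta>_def field_simps)
  have AC: "abs_cont_on {u..v} F" using F by (simp add: loc_abs_cont_def)
  obtain \<delta> where \<delta>: "\<delta> > 0"
    and ac: "\<And>q W. q tagged_partial_division_of {u..v} \<Longrightarrow> open W \<Longrightarrow> emeasure lborel W < ennreal \<delta> \<Longrightarrow>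
      \<forall>(x, k)\<in>q. k \<subseteq> W \<Longrightarrow> (\<Sum>(x, k)\<in>q. \<bar>F (Sup k) - F (Inf k)\<bar>) < e / 2"
    using abs_cont_on_tagged_partial[OF AC half_gt_zero[OF e]] by blast
  have "AE x in lborel. F differentiable (at x)" using F by (simp add: loc_abs_cont_def)
  from AE_open_cover_exceptions[OF this \<delta>] obtain W
    where W: "open W" "{x. \<not> F differentiable (at x)} \<subseteq> W" "emeasure lborel W < ennreal \<delta>" .
  \<comment> \<open>Differentiability stands as a premise inside the statement so that a radius can
    be chosen at every \<open>x\<close>; at the other points the claim is vacuous.\<close>
  have "\<exists>r>0. \<forall>c d. F differentiable (at x) \<longrightarrow> c \<le> x \<longrightarrow> x \<le> d \<longrightarrow> {c..d} \<subseteq> ball x r \<longrightarrow>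
      \<bar>F d - F c\<bar> \<le> (C + \<eta>) * (d - c)" for x
  proof (cases "F differentiable (at x)")
    case True
    then show ?thesis using derivative_straddle[OF True C \<eta>(1)] by blast
  next
    case False
    then show ?thesis by (intro exI[of _ 1]) simp
  qed
  then obtain r where r: "\<And>x. r x > 0" "\<And>x c d. F differentiable (at x) \<Longrightarrow> c \<le> x \<Longrightarrow> x \<le> d \<Longrightarrow>
      {c..d} \<subseteq> ball x (r x) \<Longrightarrow> \<bar>F d - F c\<bar> \<le> (C + \<eta>) * (d - c)"
    by metis
  define \<gamma> where "\<gamma> x = (if F differentiable (at x) then ball x (r x) else W)" for x
  have "gauge \<gamma>" using r(1) W by (intro gaugeI) (auto simp: \<gamma>_def)
  then obtain P where P: "P tagged_division_of {u..v}" "\<gamma> fine P"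
    by (rule fine_division_exists_real)
  have fine: "k \<subseteq> \<gamma> x" if "(x, k) \<in> P" for x k using P(2) that by (auto simp: fine_def)
  define Q where "Q = {(x, k) \<in> P. F differentiable (at x)}"
  define R where "R = {(x, k) \<in> P. \<not> F differentiable (at x)}"
  have PQR: "P = Q \<union> R" "Q \<inter> R = {}" "finite P" using P by (auto simp: Q_def R_def)
  have fin: "finite Q" "finite R" using PQR by auto
  have int: "\<exists>c d. k = {c..d} \<and> c \<le> x \<and> x \<le> d \<and> c \<le> d" if "(x, k) \<in> P" for x k
    using tagged_division_ofD(2,4)[OF P(1) that] by fastforce
  have len: "(\<Sum>(x, k)\<in>P. Sup k - Inf k) = v - u"
    using additive_tagged_division_1[OF uv P(1), of "\<lambda>x. x"] .
  have "\<bar>F v - F u\<bar> = \<bar>\<Sum>(x, k)\<in>P. F (Sup k) - F (Inf k)\<bar>"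
    using additive_tagged_division_1[OF uv P(1), of F] by simp
  also have "\<dots> \<le> (\<Sum>(x, k)\<in>P. \<bar>F (Sup k) - F (Inf k)\<bar>)"
    by (rule order_trans[OF sum_abs]) (simp add: case_prod_unfold)
  also have "\<dots> = (\<Sum>(x, k)\<in>Q. \<bar>F (Sup k) - F (Inf k)\<bar>) + (\<Sum>(x, k)\<in>R. \<bar>F (Sup k) - F (Inf k)\<bar>)"
    using PQR fin by (simp add: sum.union_disjoint)
  also have "(\<Sum>(x, k)\<in>R. \<bar>F (Sup k) - F (Inf k)\<bar>) < e / 2"
  proof (rule ac[of _ W])
    show "R tagged_partial_division_of {u..v}"
      using P(1) unfolding tagged_division_of_def
      by (auto intro: tagged_partial_division_subset simp: R_def)
    show "\<forall>(x, k)\<in>R. k \<subseteq> W"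
      using fine unfolding R_def \<gamma>_def by fastforce
  qed (use W in auto)
  also have "(\<Sum>(x, k)\<in>Q. \<bar>F (Sup k) - F (Inf k)\<bar>) \<le> (\<Sum>(x, k)\<in>Q. (C + \<eta>) * (Sup k - Inf k))"
  proof (rule sum_mono, clarify)
    fix x k assume xk: "(x, k) \<in> Q"
    then obtain c d where cd: "k = {c..d}" "c \<le> x" "x \<le> d" "c \<le> d" using int by (force simp: Q_def)
    moreover have "k \<subseteq> ball x (r x)" using xk fine[of x k] by (auto simp: Q_def \<gamma>_def)
    ultimately show "\<bar>F (Sup k) - F (Inf k)\<bar> \<le> (C + \<eta>) * (Sup k - Inf k)"
      using xk r(2)[of x c d] by (auto simp: Q_def)
  qed
  \<comment> \<open>Since \<open>C + \<eta> > 0\<close>, the added terms are nonnegative; over all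
    of \<open>P\<close> the lengths sum to \<open>v - u\<close>.\<close>
  also have "\<dots> \<le> (\<Sum>(x, k)\<in>P. (C + \<eta>) * (Sup k - Inf k))"
  proof (rule sum_mono2)
    show "0 \<le> (case y of (x, k) \<Rightarrow> (C + \<eta>) * (Sup k - Inf k))" if "y \<in> P - Q" for y
      using that int[of "fst y" "snd y"] C[of 0] \<eta>(1) by (cases y) auto
  qed (use PQR in auto)
  also have "\<dots> = (C + \<eta>) * (v - u)"
    by (simp add: len[symmetric] sum_distrib_left case_prod_unfold)
  finally have "\<bar>F v - F u\<bar> \<le> (C + \<eta>) * (v - u) + e / 2" by simp
  then show "\<bar>F v - F u\<bar> \<le> C * (v - u) + e" using \<eta>(2) by (simp add: algebra_simps)
qed

lemma abs_cont_on_lipschitz: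
  assumes F: "L-lipschitz_on I F"
  shows "abs_cont_on I F"
  unfolding abs_cont_on_def
proof (intro allI impI)
  fix e :: real assume e: "e > 0"
  have L: "L \<ge> 0" using F by (rule lipschitz_on_nonneg)
  show "\<exists>\<delta>>0. \<forall>(n::nat) u v. (\<forall>i<n. u i \<le> v i \<and> {u i..v i} \<subseteq> I) \<and>
      (\<forall>i<n. \<forall>j<n. i \<noteq> j \<longrightarrow> {u i<..<v i} \<inter> {u j<..<v j} = {}) \<and> (\<Sum>i<n. v i - u i) < \<delta>
      \<longrightarrow> (\<Sum>i<n. \<bar>F (v i) - F (u i)\<bar>) < e"
  \<comment> \<open>Dividing by \<open>L + 1\<close> rather than \<open>L\<close> allows
    \<open>L = 0\<close>.\<close>
  proof (intro exI[of _ "e / (L + 1)"] conjI allI impI)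
    fix n :: nat and u v :: "nat \<Rightarrow> real"
    assume *: "(\<forall>i<n. u i \<le> v i \<and> {u i..v i} \<subseteq> I) \<and>
      (\<forall>i<n. \<forall>j<n. i \<noteq> j \<longrightarrow> {u i<..<v i} \<inter> {u j<..<v j} = {}) \<and> (\<Sum>i<n. v i - u i) < e / (L + 1)"
    have "(\<Sum>i<n. \<bar>F (v i) - F (u i)\<bar>) \<le> (\<Sum>i<n. L * (v i - u i))"
    proof (rule sum_mono)
      fix i assume "i \<in> {..<n}"
      with * have i: "u i \<le> v i" "{u i..v i} \<subseteq> I" by auto
      then have "u i \<in> I" "v i \<in> I" by auto
      show "\<bar>F (v i) - F (u i)\<bar> \<le> L * (v i - u i)"
        using lipschitz_onD[OF F \<open>v i \<in> I\<close> \<open>u i \<in> I\<close>] i(1) by (simp add: dist_real_def)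
    qed
    also have "\<dots> = L * (\<Sum>i<n. v i - u i)" by (simp add: sum_distrib_left)
    also have "\<dots> \<le> L * (e / (L + 1))" using * L by (intro mult_left_mono) auto
    also have "\<dots> < e" using e L by (simp add: field_simps)
    finally show "(\<Sum>i<n. \<bar>F (v i) - F (u i)\<bar>) < e" .
  qed (use e L in auto)
qed

lemma loc_abs_cont_if_lipschitz:
  assumes "L-lipschitz_on UNIV F" "AE x in lborel. F differentiable (at x)"
  shows "loc_abs_cont UNIV F"
proof -
  have "abs_cont_on {u..v} F" for u v
    by (rule abs_cont_on_lipschitz, rule lipschitz_on_subset[OF assms(1)]) simp
  then show ?thesis using assms(2) by (simp add: loc_abs_cont_def)
qed

lemma loc_abs_cont_bounded_rderiv_lipschitz:
  assumes "loc_abs_cont UNIV F" and C: "\<And>x. \<bar>rderiv F x\<bar> \<le> C"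
  shows "C-lipschitz_on UNIV F"
proof (rule lipschitz_onI)
  show "C \<ge> 0" using C[of 0] by linarith
  show "dist (F x) (F y) \<le> C * dist x y" for x y
    using loc_abs_cont_increment_le[OF assms, of x y] loc_abs_cont_increment_le[OF assms, of y x]
    by (cases "x \<le> y") (auto simp: dist_real_def abs_minus_commute)
qed

lemma bounded_deriv_lipschitz:
  fixes F :: "real \<Rightarrow> real"
  assumes F: "\<And>x. (F has_real_derivative G x) (at x)" and C: "\<And>x. \<bar>G x\<bar> \<le> C"
  shows "C-lipschitz_on UNIV F"
proof (rule lipschitz_onI)
  show "C \<ge> 0" using C[of 0] by linarith
  show "dist (F x) (F y) \<le> C * dist x y" for x y
    using field_differentiable_bound[of UNIV F G C x y] F C by (simp add: dist_real_def)
qed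

text \<open>Difference quotients are bounded by \<open>L\<close>, hence so is their limit; where it
  does not exist, the default value 0 obeys the bound as well.\<close>

lemma rderiv_lipschitz_le:
  assumes F: "L-lipschitz_on UNIV F"
  shows "\<bar>rderiv F x\<bar> \<le> L"
proof (cases "F differentiable (at x)")
  case True
  have "((\<lambda>y. (F y - F x) / (y - x)) \<longlongrightarrow> rderiv F x) (at x)"
    using has_rderiv[OF True] by (simp add: has_field_derivative_iff)
  then have "((\<lambda>y. \<bar>(F y - F x) / (y - x)\<bar>) \<longlongrightarrow> \<bar>rderiv F x\<bar>) (at x)"
    by (rule tendsto_rabs)
  moreover have "\<bar>(F y - F x) / (y - x)\<bar> \<le> L" if "y \<noteq> x" for y
    using lipschitz_onD[OF F, of y x] that by (simp add: dist_real_def abs_divide pos_divide_le_eq)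
  then have "\<forall>\<^sub>F y in at x. \<bar>(F y - F x) / (y - x)\<bar> \<le> L"
    by (simp add: eventually_at_filter)
  ultimately show ?thesis by (rule tendsto_upperbound) simp
qed (use lipschitz_on_nonneg[OF F] in \<open>simp add: rderiv_def\<close>)

lemma Cb_1_lipschitz:
  assumes "L-lipschitz_on UNIV F" "AE x in lborel. F differentiable (at x)" "\<And>x. \<bar>F x\<bar> \<le> B"
  shows "Cb 1 F"
proof -
  have "loc_abs_cont UNIV F"
    using assms(1,2) by (rule loc_abs_cont_if_lipschitz)
  moreover have "bounded (range F)" "bounded (range (rderiv F))"
    using assms(3) rderiv_lipschitz_le[OF assms(1)] by (auto intro!: boundedI)
  ultimately show ?thesis by (auto simp: Cb_def has_derivs_on_def le_Suc_eq)
qed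

section \<open>Functions in \<open>Cb m\<close>: Lipschitz bounds and finite norms\<close>

lemma Cb_bounded:
  assumes "Cb m h" "j \<le> m"
  obtains C where "\<And>x. \<bar>(rderiv ^^ j) h x\<bar> \<le> C"
  using assms by (auto simp: Cb_def bounded_iff)

lemma Cb_differentiable: "Cb m h \<Longrightarrow> j + 1 < m \<Longrightarrow> (rderiv ^^ j) h differentiable (at x)"
  by (cases m) (auto simp: Cb_def has_derivs_on_def)

text \<open>Below order \<open>m - 1\<close> this is the mean value inequality. At order
  \<open>m - 1\<close> the next derivative exists only almost everywhere, and the increment bound
  for absolutely continuous functions replaces it.\<close>

lemma Cb_deriv_lipschitz:
  assumes h: "Cb m h" and j: "j < m"
  obtains L where "L-lipschitz_on UNIV ((rderiv ^^ j) h)"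
proof -
  obtain C where C: "\<And>x. \<bar>(rderiv ^^ (Suc j)) h x\<bar> \<le> C"
    using Cb_bounded[OF h, of "Suc j"] j by (metis Suc_leI)
  show ?thesis
  proof (cases "j + 1 < m")
    case True
    then have "((rderiv ^^ j) h has_real_derivative (rderiv ^^ (Suc j)) h x) (at x)" for x
      using has_rderiv[OF Cb_differentiable[OF h]] by simp
    then show ?thesis using C by (intro that bounded_deriv_lipschitz)
  next
    case False
    then have "m = Suc j" using j by simp
    then have "loc_abs_cont UNIV ((rderiv ^^ j) h)" using h by (simp add: Cb_def has_derivs_on_def)
    then show ?thesis using C by (intro that loc_abs_cont_bounded_rderiv_lipschitz) auto
  qed
qed

lemma Cb_AE_differentiable:
  assumes h: "Cb m h" and j: "j < m"
  shows "AE x in lborel. (rderiv ^^ j) h differentiable (at x)"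
proof (cases "j + 1 < m")
  case True
  then show ?thesis using Cb_differentiable[OF h] by simp
next
  case False
  then have "m = Suc j" using j by simp
  then show ?thesis using h by (simp add: Cb_def has_derivs_on_def loc_abs_cont_def)
qed

text \<open>For \<open>j < m\<close> the absolute continuity of the derivative of order
  \<open>j - 1\<close> is not part of \<open>Cb m h\<close>; it comes from the Lipschitz
  bound.\<close>

lemma Cb_has_derivs_on:
  assumes h: "Cb m h" and j: "j \<le> m"
  shows "has_derivs_on UNIV j h"
proof (cases j)
  case (Suc i)
  then have i: "i < m" using j by simp
  obtain L where "L-lipschitz_on UNIV ((rderiv ^^ i) h)" using Cb_deriv_lipschitz[OF h i] .
  then have "loc_abs_cont UNIV ((rderiv ^^ i) h)"
    using Cb_AE_differentiable[OF h i] by (rule loc_abs_cont_if_lipschitz)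
  then show ?thesis using Suc i Cb_differentiable[OF h] by (auto simp: has_derivs_on_def)
qed (simp add: has_derivs_on_def)

lemma deriv_norm_le_iff:
  "deriv_norm n f \<le> ereal B \<longleftrightarrow> has_derivs_on UNIV n f \<and> (\<forall>x. \<bar>(rderiv ^^ n) f x\<bar> \<le> B)"
  by (simp add: deriv_norm_def SUP_le_iff)

lemma deriv_norm_nonneg: "0 \<le> deriv_norm n f"
  by (auto simp: deriv_norm_def intro!: SUP_upper2[of 0])

lemma deriv_norm_finite:
  assumes "deriv_norm n f \<le> ereal B"
  obtains c where "deriv_norm n f = ereal c" "0 \<le> c" "c \<le> B"
  using assms deriv_norm_nonneg[of n f] by (cases "deriv_norm n f") auto

section \<open>Differential operators of first order\<close>

text \<open>Division by \<open>fact n\<close> makes each derivation lower the degree without a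
  factor, so at \<open>c\<close> exactly the derivative of order \<open>n\<close> is 1 and all
  others are 0.\<close>

lemma rderiv_funpow_monomial:
  "(rderiv ^^ i) (\<lambda>y. (y - c) ^ n / fact n) =
    (\<lambda>y. if i \<le> n then (y - c) ^ (n - i) / fact (n - i) else 0)"
proof (induction i)
  case (Suc i)
  have step: "rderiv (\<lambda>y. (y - c) ^ Suc k / fact (Suc k)) = (\<lambda>y. (y - c) ^ k / fact k)" for k
  proof (rule ext, rule rderiv_eq)
    fix y
    have "((\<lambda>y. y - c) has_real_derivative 1) (at y)" by (auto intro!: derivative_eq_intros)
    from DERIV_cdivide[OF DERIV_power_Suc[OF this, of k], of "fact (Suc k)"]
    have "((\<lambda>y. (y - c) ^ Suc k / fact (Suc k)) has_real_derivative
        real (Suc k) * (y - c) ^ k / (real (Suc k) * fact k)) (at y)"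
      by (simp only: fact_Suc of_nat_Suc of_nat_mult mult_1 add.commute)
    then show "((\<lambda>y. (y - c) ^ Suc k / fact (Suc k)) has_real_derivative (y - c) ^ k / fact k) (at y)"
      by (simp only: mult_divide_mult_cancel_left of_nat_eq_0_iff nat.simps simp_thms)
  qed
  have const: "rderiv (\<lambda>y. a) = (\<lambda>y. 0)" for a :: real
    by (intro ext rderiv_eq DERIV_const)
  consider "i < n" | "i = n" | "n < i" by linarith
  then show ?case
  proof cases
    case 1
    then have "(rderiv ^^ Suc i) (\<lambda>y. (y - c) ^ n / fact n) =
        rderiv (\<lambda>y. (y - c) ^ Suc (n - Suc i) / fact (Suc (n - Suc i)))"
      by (simp add: Suc.IH Suc_diff_Suc del: fact_Suc power_Suc)
    with 1 show ?thesis by (simp only: step) auto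
  next
    case 2
    then show ?thesis using Suc.IH by (simp add: const)
  next
    case 3
    then show ?thesis by (simp add: Suc.IH const)
  qed
qed simp

lemma Ck_monomial: "Ck k (\<lambda>y. (y - c) ^ n / fact n)"
proof -
  have "(\<lambda>y::real. (y - c) ^ i / fact i) differentiable (at x)" for i x
    unfolding divide_inverse
    by (intro differentiable_mult differentiable_power differentiable_diff differentiable_ident
        differentiable_const)
  moreover have "continuous_on UNIV (\<lambda>y::real. (y - c) ^ i / fact i)" for i
    by (intro continuous_intros) simp
  ultimately have "(rderiv ^^ i) (\<lambda>y. (y - c) ^ n / fact n) differentiable (at x)"
    "continuous_on UNIV ((rderiv ^^ i) (\<lambda>y. (y - c) ^ n / fact n))" for i x
    by (cases "i \<le> n"; simp add: rderiv_funpow_monomial)+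
  then show ?thesis by (simp add: Ck_def)
qed

text \<open>Testing with \<open>(y - x)\<^sup>n / n!\<close> identifies the coefficients at \<open>x\<close>, so the formula extends from smooth
  functions to arbitrary ones.\<close>

lemma diff_op_first_order:
  assumes T: "\<And>g. Ck (p + 1) g \<Longrightarrow> diff_op p c g x = A * g x + B * rderiv g x"
  shows "diff_op p c g x = A * g x + B * rderiv g x"
proof -
  \<comment> \<open>For \<open>p = 0\<close> and \<open>n = 1\<close> this says \<open>B = 0\<close>.\<close>
  have coeff: "(if n \<le> p then c n x else 0) = A * of_bool (n = 0) + B * of_bool (n = 1)" for n
  proof -
    define g where "g = (\<lambda>y. (y - x) ^ n / fact n)"
    have g: "(rderiv ^^ i) g x = of_bool (i = n)" for i
      unfolding g_def rderiv_funpow_monomial by (auto simp: power_0_left)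
    have g01: "g x = of_bool (n = 0)" "rderiv g x = of_bool (n = 1)"
      using g[of 0] g[of 1] by auto
    have "Ck (p + 1) g" unfolding g_def by (rule Ck_monomial)
    note T[OF this]
    also have "diff_op p c g x = (\<Sum>i\<le>p. c i x * of_bool (i = n))"
      unfolding diff_op_def g ..
    also have "\<dots> = (if n \<le> p then c n x else 0)"
      by (simp add: of_bool_def if_distrib cong: if_cong)
    finally show ?thesis unfolding g01 .
  qed
  \<comment> \<open>The sum is extended by a zero coefficient to \<open>Suc p\<close>, so that the
    index 1 lies in its range even for \<open>p = 0\<close>.\<close>
  have "diff_op p c g x = (\<Sum>i\<le>Suc p. (if i \<le> p then c i x else 0) * (rderiv ^^ i) g x)"
    by (simp add: diff_op_def)
  also have "\<dots> = (\<Sum>i\<le>Suc p. A * of_bool (i = 0) * (rderiv ^^ i) g x)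
      + (\<Sum>i\<le>Suc p. B * of_bool (i = 1) * (rderiv ^^ i) g x)"
    unfolding coeff by (simp only: distrib_right sum.distrib)
  also have "\<dots> = A * g x + B * rderiv g x"
    by (simp add: of_bool_def if_distrib if_distribR cong: if_cong del: sum.atMost_Suc)
  finally show ?thesis .
qed

section \<open>Sums over descending paths\<close>

text \<open>With \<open>e = m - j\<close>, this is the union of \<open>S_set m j l\<close> over all
  sizes \<open>l\<close>.\<close>

definition path_sets :: "nat \<Rightarrow> nat \<Rightarrow> nat set set" where
  "path_sets e m = {M. M \<subseteq> {e..m} \<and> {m, e} \<subseteq> M \<and>
     (\<forall>i. e \<le> i \<and> i + 1 \<le> m \<longrightarrow> M \<inter> {i, i + 1} \<noteq> {})}"

definition path_weight ::
    "(nat \<Rightarrow> real) \<Rightarrow> (nat \<Rightarrow> real) \<Rightarrow> (nat \<Rightarrow> real) \<Rightarrow> nat \<Rightarrow> nat set \<Rightarrow> real" where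
  "path_weight \<alpha> \<beta> D e M = (\<Prod>i\<in>M - {e}.
     (abs_psum \<beta> i * of_bool (i - 1 \<in> M) + abs_psum \<alpha> i * of_bool (i - 1 \<notin> M)) * D i)"

definition path_sum ::
    "(nat \<Rightarrow> real) \<Rightarrow> (nat \<Rightarrow> real) \<Rightarrow> (nat \<Rightarrow> real) \<Rightarrow> nat \<Rightarrow> nat \<Rightarrow> real" where
  "path_sum \<alpha> \<beta> D m e = (\<Sum>M\<in>path_sets e m. path_weight \<alpha> \<beta> D e M)"

lemma path_setsD:
  assumes "M \<in> path_sets e m"
  shows "M \<subseteq> {e..m}" "m \<in> M" "e \<in> M" "finite M" "\<And>i. e \<le> i \<Longrightarrow> i < m \<Longrightarrow> i \<in> M \<or> Suc i \<in> M"
  using assms finite_subset[of M "{e..m}"] by (auto simp: path_sets_def Suc_le_eq)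

lemma path_setsI:
  assumes "M \<subseteq> {e..m}" "m \<in> M" "e \<in> M" "\<And>i. e \<le> i \<Longrightarrow> i < m \<Longrightarrow> i \<in> M \<or> Suc i \<in> M"
  shows "M \<in> path_sets e m"
  using assms by (auto simp: path_sets_def Suc_le_eq)

lemma finite_path_sets [simp]: "finite (path_sets e m)"
  by (rule finite_subset[of _ "Pow {e..m}"]) (auto simp: path_sets_def)

text \<open>Each missing number \<open>i\<close> forces \<open>Suc i\<close> into \<open>M\<close>,
  and \<open>Suc i\<close> is never the bottom node. So at most \<open>card M - 1\<close> of the
  \<open>j + 1\<close> numbers are missing, that is, at most \<open>j div 2\<close>.\<close>

lemma card_path_sets:
  assumes M: "M \<in> path_sets (m - j) m" and j: "j \<le> m"
  shows "card M \<in> I_set j"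
proof -
  note M' = path_setsD[OF M]
  define C where "C = {m - j..m} - M"
  have fin: "finite C" by (simp add: C_def)
  have all: "card C + card M = j + 1"
    using card_Diff_subset[of M "{m - j..m}"] card_mono[of "{m - j..m}" M] M' j by (simp add: C_def)
  have "Suc ` C \<subseteq> M - {m - j}"
  proof clarify
    fix i assume "i \<in> C"
    then have "m - j \<le> i" "i < m" "i \<notin> M" using M'(2) by (auto simp: C_def le_less)
    then show "Suc i \<in> M - {m - j}" using M'(5)[of i] by auto
  qed
  then have "card (Suc ` C) \<le> card (M - {m - j})" using M'(4) by (intro card_mono) auto
  then have "card C \<le> card M - 1" using M' by (simp add: card_image card_Diff_singleton)
  moreover have "card M > 0" using M' by (auto simp: card_gt_0_iff)
  ultimately show ?thesis using all by (auto simp: I_set_def)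
qed

text \<open>\<open>I_set j\<close> contains every possible size of a path, so summing over
  \<open>l\<close> only groups the paths by cardinality.\<close>

lemma sum_A_coeff:
  assumes "j \<le> m"
  shows "(\<Sum>l\<in>I_set j. A_coeff \<alpha> \<beta> D m j l) = path_sum \<alpha> \<beta> D m (m - j)"
proof -
  have "S_set m j l = {M \<in> path_sets (m - j) m. card M = l}" for l
    by (auto simp: S_set_def path_sets_def)
  then have "(\<Sum>l\<in>I_set j. A_coeff \<alpha> \<beta> D m j l) =
      (\<Sum>l\<in>I_set j. \<Sum>M\<in>{M \<in> path_sets (m - j) m. card M = l}. path_weight \<alpha> \<beta> D (m - j) M)"
    by (simp add: A_coeff_def path_weight_def)
  also have "\<dots> = path_sum \<alpha> \<beta> D m (m - j)"
    unfolding path_sum_def by (rule sum.group) (use assms card_path_sets in \<open>auto simp: I_set_def\<close>)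
  finally show ?thesis .
qed

lemma path_sum_top: "path_sum \<alpha> \<beta> D m m = 1"
proof -
  have "path_sets m m = {{m}}" by (auto simp: path_sets_def)
  then show ?thesis by (simp add: path_sum_def path_weight_def)
qed

text \<open>This boundary value makes the step formula valid at \<open>e = m - 1\<close>, where
  \<open>e + 2\<close> exceeds \<open>m\<close>.\<close>

lemma path_sum_beyond: "path_sum \<alpha> \<beta> D m (Suc m) = 0"
proof -
  have "path_sets (Suc m) m = {}" by (auto simp: path_sets_def)
  then show ?thesis by (simp add: path_sum_def)
qed

text \<open>Above the bottom node \<open>e\<close>, the next node is \<open>e + 1\<close> or, if
  that is missing, necessarily \<open>e + 2\<close>.\<close>

lemma path_sets_step:
  assumes "e < m"
  shows "path_sets e m = insert e ` path_sets (e + 1) m \<union> insert e ` path_sets (e + 2) m"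
    (is "_ = ?A \<union> ?B")
proof (intro equalityI subsetI)
  fix M assume M: "M \<in> path_sets e m"
  note M' = path_setsD[OF M]
  have eq: "M = insert e (M - {e})" using M' by auto
  have sub: "M - {e} \<subseteq> {e + 1..m}" "m \<in> M - {e}" using M' assms by force+
  show "M \<in> ?A \<union> ?B"
  proof (cases "e + 1 \<in> M")
    case True
    have "M - {e} \<in> path_sets (e + 1) m"
      using sub True M'(5) by (intro path_setsI) auto
    then show ?thesis using eq by blast
  next
    case False
    \<comment> \<open>\<open>e + 1\<close> cannot be \<open>m\<close>, because \<open>m\<close>
      belongs to \<open>M\<close>.\<close>
    then have "e + 2 \<le> m" using assms M'(2) by (cases "e + 1 = m") auto
    then have "e + 2 \<in> M" using M'(5)[of "e + 1"] False by auto
    moreover have "M - {e} \<subseteq> {e + 2..m}"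
    proof
      fix x assume x: "x \<in> M - {e}"
      then have "e + 1 \<le> x" "x \<le> m" "x \<noteq> e + 1" using sub False by auto
      then show "x \<in> {e + 2..m}" by auto
    qed
    ultimately have "M - {e} \<in> path_sets (e + 2) m"
      using sub M'(5) by (intro path_setsI) auto
    then show ?thesis using eq by blast
  qed
next
  fix M assume "M \<in> ?A \<union> ?B"
  then consider M' where "M = insert e M'" "M' \<in> path_sets (e + 1) m"
    | M' where "M = insert e M'" "M' \<in> path_sets (e + 2) m" by auto
  then show "M \<in> path_sets e m"
  proof cases
    case 1
    note M' = path_setsD[OF 1(2)]
    show ?thesis unfolding 1(1)
    proof (rule path_setsI)
      show "i \<in> insert e M' \<or> Suc i \<in> insert e M'" if "e \<le> i" "i < m" for i
        using M'(5)[of i] that by (cases "i = e") auto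
    qed (use M' assms in auto)
  next
    case 2
    note M' = path_setsD[OF 2(2)]
    show ?thesis unfolding 2(1)
    proof (rule path_setsI)
      show "i \<in> insert e M' \<or> Suc i \<in> insert e M'" if i: "e \<le> i" "i < m" for i
      proof -
        consider "i = e" | "i = e + 1" | "e + 2 \<le> i" using i(1) by linarith
        then show ?thesis using M'(3) M'(5)[of i] i(2) by cases auto
      qed
    qed (use M' assms in auto)
  qed
qed

text \<open>A new bottom node contributes only the factor of the old bottom \<open>e'\<close>. For
  the nodes \<open>i > e'\<close>, the predecessor \<open>i - 1\<close> differs from
  \<open>e\<close>, so their factors are unchanged.\<close>

lemma path_weight_insert:
  assumes "M \<in> path_sets e' m" and "e < e'"
  shows "path_weight \<alpha> \<beta> D e (insert e M) = path_weight \<alpha> \<beta> D e' M *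
    ((abs_psum \<beta> e' * of_bool (e' = e + 1) + abs_psum \<alpha> e' * of_bool (e' \<noteq> e + 1)) * D e')"
proof -
  note M = path_setsD[OF assms(1)]
  have eM: "e \<notin> M" using M assms by auto
  define w where "w M i = (abs_psum \<beta> i * of_bool (i - 1 \<in> M) + abs_psum \<alpha> i * of_bool (i - 1 \<notin> M)) * D i"
    for M :: "nat set" and i
  have "path_weight \<alpha> \<beta> D e (insert e M) = (\<Prod>i\<in>M. w (insert e M) i)"
    using eM by (simp add: path_weight_def w_def Diff_insert_absorb)
  also have "\<dots> = w (insert e M) e' * (\<Prod>i\<in>M - {e'}. w (insert e M) i)"
    using M by (intro prod.remove) auto
  also have "(\<Prod>i\<in>M - {e'}. w (insert e M) i) = (\<Prod>i\<in>M - {e'}. w M i)"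
  proof (rule prod.cong)
    fix i assume "i \<in> M - {e'}"
    then have "e' < i" using M(1) by (force simp: le_less)
    then have "i - 1 \<noteq> e" using assms by auto
    then show "w (insert e M) i = w M i" by (simp add: w_def)
  qed simp
  also have "\<dots> = path_weight \<alpha> \<beta> D e' M" by (simp add: path_weight_def w_def)
  also have "w (insert e M) e' =
      (abs_psum \<beta> e' * of_bool (e' = e + 1) + abs_psum \<alpha> e' * of_bool (e' \<noteq> e + 1)) * D e'"
  proof -
    have "e' - 1 \<notin> M"
    proof
      assume "e' - 1 \<in> M"
      with M(1) have "e' \<le> e' - 1" by auto
      with assms(2) show False by simp
    qed
    then have "e' - 1 \<in> insert e M \<longleftrightarrow> e' = e + 1" using assms(2) by auto
    then show ?thesis by (simp only: w_def)
  qed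
  finally show ?thesis by simp
qed

lemma path_sum_step:
  assumes "e < m"
  shows "path_sum \<alpha> \<beta> D m e = path_sum \<alpha> \<beta> D m (e + 1) * (abs_psum \<beta> (e + 1) * D (e + 1))
    + path_sum \<alpha> \<beta> D m (e + 2) * (abs_psum \<alpha> (e + 2) * D (e + 2))"
proof -
  \<comment> \<open>The two kinds of paths are told apart by whether they contain
    \<open>e + 1\<close>.\<close>
  have disj: "insert e ` path_sets (e + 1) m \<inter> insert e ` path_sets (e + 2) m = {}"
  proof -
    have "e + 1 \<in> M" if "M \<in> insert e ` path_sets (e + 1) m" for M
      using that path_setsD(3) by auto
    moreover have "e + 1 \<notin> M" if "M \<in> insert e ` path_sets (e + 2) m" for M
      using that path_setsD(1) by force
    ultimately show ?thesis by blast
  qed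
  have inj: "inj_on (insert e) (path_sets e' m)" if "e < e'" for e'
  proof (rule inj_onI)
    fix M M' assume M: "M \<in> path_sets e' m" "M' \<in> path_sets e' m" and eq: "insert e M = insert e M'"
    have "e \<notin> M" "e \<notin> M'" using path_setsD(1)[OF M(1)] path_setsD(1)[OF M(2)] that by auto
    with eq show "M = M'" by (simp add: insert_ident)
  qed
  have "path_sum \<alpha> \<beta> D m e = (\<Sum>M\<in>insert e ` path_sets (e + 1) m. path_weight \<alpha> \<beta> D e M)
      + (\<Sum>M\<in>insert e ` path_sets (e + 2) m. path_weight \<alpha> \<beta> D e M)"
    unfolding path_sum_def path_sets_step[OF assms] using disj by (intro sum.union_disjoint) auto
  then show ?thesis
    by (simp add: sum.reindex inj path_weight_insert path_sum_def sum_distrib_right)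
qed

text \<open>\<open>G e\<close> is the total weight of the paths from \<open>m\<close> down to
  \<open>e\<close>. Expanding \<open>X e\<close> would visit node \<open>e - 1\<close>, so its
  coefficient is \<open>G (e - 1)\<close>; \<open>X (e - 1)\<close> has so far been reached only by
  the double step from \<open>e\<close>.\<close>

lemma unroll_second_order_recursion:
  fixes X H D a b G :: "nat \<Rightarrow> real"
  assumes X: "\<And>k. k \<ge> 1 \<Longrightarrow> k \<le> m \<Longrightarrow> X (k + 1) = D k * (H k + a k * X (k - 1) + b k * X k)"
    and G: "G m = 1" "G (m + 1) = 0"
      "\<And>e. e < m \<Longrightarrow> G e = G (e + 1) * (b (e + 1) * D (e + 1)) + G (e + 2) * (a (e + 2) * D (e + 2))"
    and e: "1 \<le> e" "e \<le> m"
  shows "X (m + 1) = (\<Sum>k=e..m. G k * D k * H k) + G (e - 1) * X e + G e * (a e * D e) * X (e - 1)"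
  using e(2,1)
proof (induction rule: inc_induct)
  case base
  \<comment> \<open>The double step drops out because \<open>G (m + 1) = 0\<close>.\<close>
  have "G (m - 1) = b m * D m" using G(3)[of "m - 1"] G(1,2) e by simp
  then show ?case using X[of m] G(1) e by (simp add: algebra_simps)
next
  case (step n)
  have "X (m + 1) = (\<Sum>k=Suc n..m. G k * D k * H k) + G n * X (n + 1) + G (n + 1) * (a (n + 1) * D (n + 1)) * X n"
    using step.IH by simp
  also have "X (n + 1) = D n * (H n + a n * X (n - 1) + b n * X n)"
    using X[of n] step.prems step.hyps by simp
  also have "(\<Sum>k=n..m. G k * D k * H k) = G n * D n * H n + (\<Sum>k=Suc n..m. G k * D k * H k)"
    using step.hyps by (intro sum.atLeast_Suc_atMost) simp
  then have "(\<Sum>k=Suc n..m. G k * D k * H k) = (\<Sum>k=n..m. G k * D k * H k) - G n * D n * H n"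
    by simp
  also have "(\<Sum>k=n..m. G k * D k * H k) - G n * D n * H n + G n * (D n * (H n + a n * X (n - 1) + b n * X n))
      + G (n + 1) * (a (n + 1) * D (n + 1)) * X n
      = (\<Sum>k=n..m. G k * D k * H k) + (G n * (b n * D n) + G (n + 1) * (a (n + 1) * D (n + 1))) * X n
      + G n * (a n * D n) * X (n - 1)"
    by (simp add: algebra_simps)
  \<comment> \<open>Single steps from \<open>n\<close> and double steps from \<open>n + 1\<close>
    together make up all paths arriving at \<open>n - 1\<close>.\<close>
  also have "G n * (b n * D n) + G (n + 1) * (a (n + 1) * D (n + 1)) = G (n - 1)"
    using G(3)[of "n - 1"] step.prems step.hyps by simp
  finally show ?case .
qed

section \<open>Stein factors and iterated Stein equations\<close>

text \<open>A centred test function of finite positive norm suffices, since the left side of the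
  bound is nonnegative.\<close>

lemma stein_factor_nonneg:
  assumes M: "prob_space M" "sets M = sets borel"
    and bound: "\<And>g. centred M g \<Longrightarrow> deriv_norm n (S g) \<le> ereal C * deriv_norm 0 g"
  shows "0 \<le> C"
proof -
  interpret prob_space M by fact
  \<comment> \<open>The values at 0 and 1 differ by 1, so \<open>g\<close> is not the zero function,
    whatever \<open>M\<close> is.\<close>
  define g :: "real \<Rightarrow> real" where "g x = indicator {0} x - prob {0}" for x
  have [measurable]: "{0::real} \<in> sets M" using M by simp
  have int: "integrable M (indicator {0} :: real \<Rightarrow> real)"
    by (rule integrable_real_indicator) (auto simp: less_top[symmetric])
  have "centred M g"
    unfolding centred_def g_def using int by (simp add: prob_space)
  from bound[OF this] have "0 \<le> ereal C * deriv_norm 0 g" using deriv_norm_nonneg order_trans by blast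
  moreover have "deriv_norm 0 g \<le> ereal 1"
    unfolding deriv_norm_le_iff by (auto simp: g_def has_derivs_on_def indicator_def)
  then obtain s where s: "deriv_norm 0 g = ereal s" "0 \<le> s" by (rule deriv_norm_finite)
  moreover have "s \<noteq> 0"
  proof
    assume "s = 0"
    then have "g x = 0" for x using s(1) deriv_norm_le_iff[of 0 g 0] by simp
    from this[of 0] this[of 1] show False by (simp add: g_def)
  qed
  ultimately show ?thesis by (simp add: zero_le_mult_iff)
qed

primrec stein_rhs ::
    "nat \<Rightarrow> (nat \<Rightarrow> nat \<Rightarrow> real \<Rightarrow> real) \<Rightarrow> (nat \<Rightarrow> (real \<Rightarrow> real) \<Rightarrow> real \<Rightarrow> real) \<Rightarrow>
      (real \<Rightarrow> real) \<Rightarrow> nat \<Rightarrow> real \<Rightarrow> real" where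
  "stein_rhs p b sol h 0 = h"
| "stein_rhs p b sol h (Suc k) =
    next_rhs p (b k) (stein_rhs p b sol h k) (sol k (stein_rhs p b sol h k))"

text \<open>The norm recursion taken with equality, where \<open>H k\<close> stands for the norm of
  the derivative of \<open>h\<close> of order \<open>k\<close>; it can then be solved
  exactly.\<close>

fun deriv_majorant ::
    "(nat \<Rightarrow> real) \<Rightarrow> (nat \<Rightarrow> real) \<Rightarrow> (nat \<Rightarrow> real) \<Rightarrow> (nat \<Rightarrow> real) \<Rightarrow> (nat \<Rightarrow> real) \<Rightarrow> nat \<Rightarrow> real" where
  "deriv_majorant \<alpha> \<beta> K D H 0 = K 0 * H 0"
| "deriv_majorant \<alpha> \<beta> K D H (Suc 0) = D 0 * H 0"
| "deriv_majorant \<alpha> \<beta> K D H (Suc (Suc k)) = D (Suc k) * (H (Suc k)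
    + abs_psum \<alpha> (Suc k) * deriv_majorant \<alpha> \<beta> K D H k
    + abs_psum \<beta> (Suc k) * deriv_majorant \<alpha> \<beta> K D H (Suc k))"

text \<open>At \<open>k = 0\<close> both partial sums are empty, which removes the terms with the
  meaningless index \<open>k - 1\<close> and makes the recursion uniform.\<close>

lemma deriv_majorant_Suc:
  "deriv_majorant \<alpha> \<beta> K D H (Suc k) = D k * (H k
    + abs_psum \<alpha> k * deriv_majorant \<alpha> \<beta> K D H (k - 1)
    + abs_psum \<beta> k * deriv_majorant \<alpha> \<beta> K D H k)"
  by (cases k) (simp_all add: abs_psum_def)

text \<open>Unrolling stops at \<open>e = 1\<close>. The remaining values \<open>D 0 * H 0\<close>
  and \<open>K 0 * H 0\<close> produce the two special terms in the coefficient of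
  \<open>H 0\<close>.\<close>

lemma deriv_majorant_closed_form:
  assumes m: "1 \<le> m"
  shows "deriv_majorant \<alpha> \<beta> K D H (m + 1) =
    (\<Sum>j=0..m - 1. D (m - j) * (\<Sum>l\<in>I_set j. A_coeff \<alpha> \<beta> D m j l) * H (m - j))
    + (D 0 * (\<Sum>l\<in>I_set m. A_coeff \<alpha> \<beta> D m m l)
        + abs_psum \<alpha> 1 * K 0 * D 1 * (\<Sum>l\<in>I_set (m - 1). A_coeff \<alpha> \<beta> D m (m - 1) l)) * H 0"
proof -
  let ?G = "path_sum \<alpha> \<beta> D m" and ?X = "deriv_majorant \<alpha> \<beta> K D H"
  have "?X (m + 1) = (\<Sum>k=1..m. ?G k * D k * H k) + ?G (1 - 1) * ?X 1
      + ?G 1 * (abs_psum \<alpha> 1 * D 1) * ?X (1 - 1)"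
  proof (rule unroll_second_order_recursion[where b = "abs_psum \<beta>"])
    show "?X (k + 1) = D k * (H k + abs_psum \<alpha> k * ?X (k - 1) + abs_psum \<beta> k * ?X k)" for k
      using deriv_majorant_Suc by simp
  qed (use m path_sum_step in \<open>auto simp: path_sum_top path_sum_beyond\<close>)
  also have "(\<Sum>k=1..m. ?G k * D k * H k) = (\<Sum>j=0..m - 1. D (m - j) * ?G (m - j) * H (m - j))"
    by (rule sum.reindex_bij_witness[of _ "\<lambda>j. m - j" "\<lambda>k. m - k"]) (use m in auto)
  also have "\<dots> = (\<Sum>j=0..m - 1. D (m - j) * (\<Sum>l\<in>I_set j. A_coeff \<alpha> \<beta> D m j l) * H (m - j))"
    by (intro sum.cong) (auto simp: sum_A_coeff)
  finally show ?thesis using m by (simp add: sum_A_coeff algebra_simps)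
qed

text \<open>It ensures that \<open>next_rhs\<close> takes its default value 0 at the same points for
  the sum as for \<open>u\<close>.\<close>

lemma differentiable_add_cancel:
  fixes u v w :: "real \<Rightarrow> real"
  assumes v: "(v has_real_derivative v') (at x)" and w: "(w has_real_derivative w') (at x)"
  shows "(\<lambda>y. u y + A * v y + B * w y) differentiable (at x) \<longleftrightarrow> u differentiable (at x)" (is ?diff)
    and "u differentiable (at x) \<Longrightarrow>
      deriv (\<lambda>y. u y + A * v y + B * w y) x = rderiv u x + A * v' + B * w'"
proof -
  have *: "((\<lambda>y. A * v y + B * w y) has_real_derivative A * v' + B * w') (at x)"
    by (intro DERIV_add DERIV_cmult v w)
  show deriv: "deriv (\<lambda>y. u y + A * v y + B * w y) x = rderiv u x + A * v' + B * w'"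
    if "u differentiable (at x)"
    using DERIV_add[OF has_rderiv[OF that] *] by (intro DERIV_imp_deriv) (simp add: add.assoc)
  show ?diff
  proof
    assume "(\<lambda>y. u y + A * v y + B * w y) differentiable (at x)"
    from DERIV_diff[OF has_rderiv[OF this] *] show "u differentiable (at x)"
      by (auto simp: real_differentiable_def add.assoc)
  next
    assume "u differentiable (at x)"
    from DERIV_add[OF has_rderiv[OF this] *] show "(\<lambda>y. u y + A * v y + B * w y) differentiable (at x)"
      by (auto simp: real_differentiable_def add.assoc)
  qed
qed

theorem lemma2p5:
  fixes N :: enat and p m :: nat
    and \<mu> :: "nat \<Rightarrow> real measure"
    and a b :: "nat \<Rightarrow> nat \<Rightarrow> real \<Rightarrow> real"
    and sol :: "nat \<Rightarrow> (real \<Rightarrow> real) \<Rightarrow> real \<Rightarrow> real"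
    and \<alpha> \<beta> K D :: "nat \<Rightarrow> real"
    and h f :: "real \<Rightarrow> real"
  assumes system: "stein_system N p \<mu> a b sol"
    and T_form: "\<And>j g x. enat j < N + 1 \<Longrightarrow> Ck (p + 1) g \<Longrightarrow>
      diff_op p (b j) g x = \<alpha> (j + 1) * g x + \<beta> (j + 1) * rderiv g x"
    and m: "1 \<le> m" "enat m < N + 1"
    and h: "Cb m h" "centred (\<mu> 0) h"
    and f: "f = sol 0 h"
    and K_bound: "\<And>j g. enat j < N + 1 \<Longrightarrow> centred (\<mu> j) g \<Longrightarrow>
      deriv_norm 0 (sol j g) \<le> ereal (K j) * deriv_norm 0 g"
    and D_bound: "\<And>j g. enat j < N + 1 \<Longrightarrow> centred (\<mu> j) g \<Longrightarrow>
      deriv_norm 1 (sol j g) \<le> ereal (D j) * deriv_norm 0 g"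
  shows "deriv_norm (m + 1) f \<le>
    (\<Sum>j=0..m - 1. ereal (D (m - j) * (\<Sum>l\<in>I_set j. A_coeff \<alpha> \<beta> D m j l)) * deriv_norm (m - j) h)
    + ereal (D 0 * (\<Sum>l\<in>I_set m. A_coeff \<alpha> \<beta> D m m l)
        + abs_psum \<alpha> 1 * K 0 * D 1 * (\<Sum>l\<in>I_set (m - 1). A_coeff \<alpha> \<beta> D m (m - 1) l)) * deriv_norm 0 h"
proof -
  interpret stein_system N p \<mu> a b sol by (rule system)

  \<comment> \<open>Consequences of the hypotheses at the levels up to \<open>m\<close>\<close>
  have level: "enat k < N + 1" if "k \<le> m" for k
    using m(2) that by (meson enat_ord_simps(1) le_less_trans)
  \<comment> \<open>The hypothesis speaks of functions of class \<open>Ck (p + 1)\<close>; the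
    solutions to which it is applied may be less regular.\<close>
  have T: "diff_op p (b k) g x = \<alpha> (k + 1) * g x + \<beta> (k + 1) * rderiv g x" if "k \<le> m" for k g x
    by (rule diff_op_first_order) (rule T_form[OF level[OF that]])
  have D_nonneg: "0 \<le> D k" if "k \<le> m" for k
    by (rule stein_factor_nonneg[where S = "sol k" and n = 1 and M = "\<mu> k"])
      (use prob[OF level[OF that]] D_bound[OF level[OF that]] in auto)

  define H where "H i = real_of_ereal (deriv_norm i h)" for i
  have H: "deriv_norm i h = ereal (H i)" if i: "i \<le> m" for i
  proof -
    obtain C where "\<And>x. \<bar>(rderiv ^^ i) h x\<bar> \<le> C" using Cb_bounded[OF h(1) i] by blast
    then have "deriv_norm i h \<le> ereal C"
      using Cb_has_derivs_on[OF h(1) i] by (simp add: deriv_norm_le_iff)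
    then obtain c where "deriv_norm i h = ereal c" by (rule deriv_norm_finite)
    then show ?thesis by (simp add: H_def)
  qed
  have H_bound: "\<bar>(rderiv ^^ i) h x\<bar> \<le> H i" if "i \<le> m" for i x
    using H[OF that] deriv_norm_le_iff[of i h "H i"] by simp

  \<comment> \<open>The iterated equations and their majorant\<close>
  define X where "X = deriv_majorant \<alpha> \<beta> K D H"
  define bound where "bound k = H k + abs_psum \<alpha> k * X (k - 1) + abs_psum \<beta> k * X k" for k
  have X_Suc: "X (Suc k) = D k * bound k" for k
    unfolding X_def bound_def by (rule deriv_majorant_Suc)
  define u where "u k = stein_rhs p b sol h k" for k
  define g where "g k = sol k (u k)" for k
  have u_0: "u 0 = h" and u_Suc: "u (Suc k) = next_rhs p (b k) (u k) (g k)" for k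
    by (simp_all add: u_def g_def)

  \<comment> \<open>A finite bound on \<open>deriv_norm 1\<close> yields absolute continuity and a
    derivative almost everywhere, not yet a derivative at every point.\<close>
  have deriv_g: "loc_abs_cont UNIV (g k) \<and> (\<forall>x. \<bar>rderiv (g k) x\<bar> \<le> X (Suc k))"
    if "k \<le> m" "centred (\<mu> k) (u k)" "\<And>x. \<bar>u k x\<bar> \<le> bound k" for k
  proof -
    have "deriv_norm 0 (u k) \<le> ereal (bound k)"
      using that(3) by (simp add: deriv_norm_le_iff has_derivs_on_def)
    then have "ereal (D k) * deriv_norm 0 (u k) \<le> ereal (D k) * ereal (bound k)"
      using D_nonneg[OF that(1)] by (intro ereal_mult_left_mono) auto
    then have "deriv_norm 1 (g k) \<le> ereal (X (Suc k))"
      using D_bound[OF level[OF that(1)] that(2)] unfolding g_def X_Suc by simp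
    then show ?thesis by (simp add: deriv_norm_le_iff has_derivs_on_def)
  qed

  \<comment> \<open>Induction on the level\<close>
  define sum\<alpha> where "sum\<alpha> k = (\<Sum>i=1..k. \<alpha> i)" for k
  define sum\<beta> where "sum\<beta> k = (\<Sum>i=1..k. \<beta> i)" for k
  \<comment> \<open>The formula for \<open>u k\<close> is confined to \<open>k < m\<close>: at level
    \<open>m\<close> the function \<open>u m\<close> is 0 wherever the derivative of
    \<open>h\<close> of order \<open>m\<close> fails to exist, and the formula may fail
    there.\<close>
  define inv where "inv k \<longleftrightarrow> centred (\<mu> k) (u k) \<and> (\<forall>x. \<bar>u k x\<bar> \<le> bound k) \<and>
      (k < m \<longrightarrow> u k = (\<lambda>x. (rderiv ^^ k) h x + sum\<alpha> k * g (k - 1) x + sum\<beta> k * g k x)) \<and>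
      (\<forall>x. \<bar>g k x\<bar> \<le> X k) \<and> (\<forall>j<k. \<forall>x. (g j has_real_derivative g (Suc j) x) (at x))" for k
  have inv: "inv k" if "k \<le> m" for k
    using that
  proof (induction k)
    case 0
    have "\<bar>g 0 x\<bar> \<le> X 0" for x
      using K_bound[OF level[of 0] h(2)] H[of 0] deriv_norm_le_iff[of 0 "g 0" "X 0"]
      by (simp add: g_def u_0 X_def)
    moreover have "\<bar>h x\<bar> \<le> bound 0" for x
      using H_bound[of 0 x] by (simp add: bound_def abs_psum_def)
    ultimately show ?case using h(2) by (simp add: inv_def u_0 sum\<alpha>_def sum\<beta>_def)
  next
    case (Suc k)
    then have k: "k < m" "k \<le> m" and IH: "inv k" by auto
    have cen: "centred (\<mu> k) (u k)" and u_le: "\<And>x. \<bar>u k x\<bar> \<le> bound k"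
      and u_eq: "u k = (\<lambda>x. (rderiv ^^ k) h x + sum\<alpha> k * g (k - 1) x + sum\<beta> k * g k x)"
      and g_le: "\<And>x. \<bar>g k x\<bar> \<le> X k"
      and g_chain: "\<And>j x. j < k \<Longrightarrow> (g j has_real_derivative g (Suc j) x) (at x)"
      using IH k(1) by (auto simp: inv_def)
    have g_ac: "loc_abs_cont UNIV (g k)" and g'_le: "\<And>x. \<bar>rderiv (g k) x\<bar> \<le> X (Suc k)"
      using deriv_g[OF k(2) cen u_le] by auto
    obtain L where Lh: "L-lipschitz_on UNIV ((rderiv ^^ k) h)" using Cb_deriv_lipschitz[OF h(1) k(1)] .
    have Lg: "(X (Suc k))-lipschitz_on UNIV (g k)" by (rule loc_abs_cont_bounded_rderiv_lipschitz[OF g_ac g'_le])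
    have g_AE: "AE x in lborel. g k differentiable (at x)" using g_ac by (simp add: loc_abs_cont_def)
    have g_prev: "(g (k - 1) has_real_derivative g k x) (at x)" if "0 < k" for x
      using g_chain[of "k - 1"] that by simp
    \<comment> \<open>For \<open>k > 0\<close> the derivative of \<open>g (k - 1)\<close> is
      \<open>g k\<close>, which is bounded by \<open>X k\<close>; for \<open>k = 0\<close> the
      coefficient vanishes.\<close>
    have prev: "\<exists>L. L-lipschitz_on UNIV (\<lambda>x. sum\<alpha> k * g (k - 1) x)"
    proof (cases "k = 0")
      case True
      then show ?thesis by (intro exI[of _ 0] lipschitz_onI) (auto simp: sum\<alpha>_def)
    next
      case False
      then have "(X k)-lipschitz_on UNIV (g (k - 1))"
        using g_prev g_le by (intro bounded_deriv_lipschitz) auto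
      from lipschitz_on_cmult_real[OF this] show ?thesis by blast
    qed
    then obtain L' where L': "L'-lipschitz_on UNIV (\<lambda>x. sum\<alpha> k * g (k - 1) x)" ..
    have "(L + L' + \<bar>sum\<beta> k\<bar> * X (Suc k))-lipschitz_on UNIV (u k)"
      unfolding u_eq by (intro lipschitz_on_add Lh L' lipschitz_on_cmult_real Lg)
    moreover have "AE x in lborel. u k differentiable (at x)"
      using Cb_AE_differentiable[OF h(1) k(1)] g_AE
    proof eventually_elim
      case (elim x)
      have "(\<lambda>x. sum\<alpha> k * g (k - 1) x) differentiable (at x)"
      proof (cases "k = 0")
        case False
        then show ?thesis
          by (intro differentiable_mult differentiable_const real_differentiableI[OF g_prev]) simp
      qed (simp add: sum\<alpha>_def)
      moreover have "(\<lambda>x. sum\<beta> k * g k x) differentiable (at x)"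
        by (intro differentiable_mult differentiable_const elim)
      ultimately show ?case unfolding u_eq by (intro differentiable_add elim)
    qed
    ultimately have Cb: "Cb 1 (u k)" using u_le by (rule Cb_1_lipschitz)
    have lev: "enat (k + 1) < N + 1" using level[of "k + 1"] k(1) by simp
    \<comment> \<open>Membership of \<open>u k\<close> in \<open>Cb 1\<close> gives access to the
      next level, where the almost everywhere derivative of \<open>g k\<close> becomes one at every
      point.\<close>
    have cen': "centred (\<mu> (Suc k)) (u (Suc k))"
      using next_centred[OF lev cen Cb] by (simp add: u_Suc g_def)
    have g_deriv: "(g k has_real_derivative g (Suc k) x) (at x)" for x
      using next_solution[OF lev cen Cb] by (simp add: u_Suc g_def)
    have g_next: "rderiv (g k) x = g (Suc k) x" for x by (rule rderiv_eq[OF g_deriv])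
    \<comment> \<open>Now that \<open>g k\<close> is known to be differentiable everywhere, \<open>u k\<close> and \<open>h\<^sup>(\<^sup>k\<^sup>)\<close> are differentiable at the
      same points.\<close>
    have u_next: "u (Suc k) x = (if (rderiv ^^ k) h differentiable (at x) then
        (rderiv ^^ Suc k) h x + sum\<alpha> (Suc k) * g k x + sum\<beta> (Suc k) * g (Suc k) x else 0)" for x
    proof -
      let ?\<eta> = "(rderiv ^^ k) h"
      have "(u k differentiable (at x) \<longleftrightarrow> ?\<eta> differentiable (at x)) \<and>
          (?\<eta> differentiable (at x) \<longrightarrow>
            deriv (u k) x = rderiv ?\<eta> x + sum\<alpha> k * g k x + sum\<beta> k * g (Suc k) x)"
      proof (cases "k = 0")
        case True
        then show ?thesis
          unfolding u_eq by (simp add: sum\<alpha>_def sum\<beta>_def rderiv_def)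
      next
        case False
        then have "(g (k - 1) has_real_derivative g k x) (at x)" by (intro g_prev) simp
        from differentiable_add_cancel[OF this g_deriv, where u = ?\<eta>] show ?thesis
          unfolding u_eq by blast
      qed
      moreover have "diff_op p (b k) (g k) x = \<alpha> (Suc k) * g k x + \<beta> (Suc k) * g (Suc k) x"
        using T[OF k(2), of "g k"] by (simp add: g_next)
      ultimately show ?thesis
        unfolding u_Suc next_rhs_def by (simp add: sum\<alpha>_def sum\<beta>_def algebra_simps)
    qed
    have u_next_le: "\<bar>u (Suc k) x\<bar> \<le> bound (Suc k)" for x
    proof -
      have "\<bar>(rderiv ^^ Suc k) h x + sum\<alpha> (Suc k) * g k x + sum\<beta> (Suc k) * g (Suc k) x\<bar>
          \<le> \<bar>(rderiv ^^ Suc k) h x\<bar> + \<bar>sum\<alpha> (Suc k) * g k x\<bar> + \<bar>sum\<beta> (Suc k) * g (Suc k) x\<bar>"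
        by linarith
      also have "\<dots> \<le> bound (Suc k)"
        unfolding bound_def abs_psum_def sum\<alpha>_def[symmetric] sum\<beta>_def[symmetric] abs_mult
        using H_bound[of "Suc k" x] k(1) g_le[of x] g'_le[of x]
        by (intro add_mono mult_left_mono) (auto simp: g_next)
      finally have "\<bar>(rderiv ^^ Suc k) h x + sum\<alpha> (Suc k) * g k x + sum\<beta> (Suc k) * g (Suc k) x\<bar>
          \<le> bound (Suc k)" .
      \<comment> \<open>At the exceptional points the value is 0, and \<open>bound (Suc k)\<close>
        is nonnegative because it dominates an absolute value.\<close>
      then show ?thesis unfolding u_next by (auto intro: order_trans[OF abs_ge_zero])
    qed
    have "u (Suc k) = (\<lambda>x. (rderiv ^^ Suc k) h x + sum\<alpha> (Suc k) * g (Suc k - 1) x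
        + sum\<beta> (Suc k) * g (Suc k) x)" if "Suc k < m"
      using u_next Cb_differentiable[OF h(1), of k] that by auto
    moreover have "\<bar>g (Suc k) x\<bar> \<le> X (Suc k)" for x using g'_le[of x] by (simp add: g_next)
    ultimately show ?case
      using cen' u_next_le g_deriv g_chain unfolding inv_def less_Suc_eq by blast
  qed

  \<comment> \<open>Identification of the derivatives of \<open>f\<close> and conclusion\<close>
  have chain: "(g j has_real_derivative g (Suc j) x) (at x)" if "j < m" for j x
    using inv[of m] that by (auto simp: inv_def)
  have iter: "(rderiv ^^ j) f = g j" if "j \<le> m" for j
    using that
  proof (induction j)
    case 0
    then show ?case by (simp add: f g_def u_0)
  next
    case (Suc j)
    then show ?case using rderiv_eq[OF chain[of j]] by auto
  qed
  \<comment> \<open>At the top level absolute continuity of \<open>g m\<close> is exactly what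
    \<open>has_derivs_on\<close> demands for the derivative of order \<open>m + 1\<close>.\<close>
  have "loc_abs_cont UNIV (g m)" "\<And>x. \<bar>rderiv (g m) x\<bar> \<le> X (Suc m)"
    using deriv_g[of m] inv[of m] by (auto simp: inv_def)
  then have "deriv_norm (m + 1) f \<le> ereal (X (m + 1))"
    using real_differentiableI[OF chain]
    by (simp add: deriv_norm_le_iff has_derivs_on_def iter)
  also have "\<dots> = (\<Sum>j=0..m - 1. ereal (D (m - j) * (\<Sum>l\<in>I_set j. A_coeff \<alpha> \<beta> D m j l)) * deriv_norm (m - j) h)
    + ereal (D 0 * (\<Sum>l\<in>I_set m. A_coeff \<alpha> \<beta> D m m l)
        + abs_psum \<alpha> 1 * K 0 * D 1 * (\<Sum>l\<in>I_set (m - 1). A_coeff \<alpha> \<beta> D m (m - 1) l)) * deriv_norm 0 h"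
    unfolding X_def deriv_majorant_closed_form[OF m(1)] by (simp add: H)
  finally show ?thesis .
qed

end
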